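(* Let $d\ge 2$ be a constant, let $G$ be the intersection graph of a set of $n$ similarly-sized fat objects in $\mathbb{R}^d$, and let $\mathcal{P}$ be a $\kappa$-partition of $G$ such that $G_{\mathcal{P}}$ has maximum degree at most $\Delta$, where $\kappa,\Delta$ are constants. Let $\mathcal{A}$ be an algorithm for solving a problem on $G$ that takes as input $(G,d,\mathcal{P},G_{\mathcal{P}})$ and a treedepth decomposition $(F,\varphi)$ of $G_{\mathcal{P}}$ of weighted depth $O(n^{1-1/d})$ (and optionally additional inputs of polynomial size). Suppose $\mathcal{A}$ is a recursive algorithm which uses $(F,\varphi)$ as follows: at every node $u\in V(F)$ it spends time $2^{O(\omega(u))}\cdot n^{O(1)}$, uses polynomial space, and makes at most $2^{O(\omega(u))}$ recursive calls on the children of $u$. Then $\mathcal{A}$ runs in time $2^{O(n^{1-1/d})}$ and uses polynomial space.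
   Context: A set of objects in $\mathbb{R}^d$ is a set of similarly-sized fat objects if there are constants such that every object $g$ satisfies $B_{in}\subseteq g\subseteq B_{out}$ for balls whose radius ratio is bounded by a constant, and the ratio of the largest to the smallest diameter is bounded by a constant; its intersection graph has an edge between two objects iff they intersect. A $\kappa$-partition of $G$ is a partition $\mathcal{P}=\{V_1,\dots,V_t\}$ of $V(G)$ such that each $G[V_i]$ is connected and is a union of at most $\kappa$ cliques of $G$; $G_{\mathcal{P}}$ is obtained by contracting each $V_i$ to a vertex and removing loops and parallel edges. A treedepth decomposition of $G_{\mathcal{P}}$ is a pair $(F,\varphi)$, $F$ a rooted forest and $\varphi:V(F)\to\mathcal{P}$ a bijection such that adjacent vertices of $G_{\mathcal{P}}$ are mapped from ancestor–descendant pairs of $F$. For $u\in V(F)$, $\omega(u)=\log(1+|\varphi(u)|)$; the weighted depth of $(F,\varphi)$ is the maximum over root-to-leaf paths of the sum of $\omega$ along the path. *)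

theory Defs
  imports "HOL-Analysis.Analysis" "HOL-Library.Disjoint_Sets" "Graph_Theory.Graph_Theory"
begin

section \<open>Similarly-sized fat objects and their intersection graphs\<close>

definition similarly_sized_fat :: "real \<Rightarrow> real \<Rightarrow> 'a::euclidean_space set set \<Rightarrow> bool" where
  "similarly_sized_fat \<rho> \<sigma> S \<longleftrightarrow>
     (\<forall>g\<in>S. \<exists>a b r R. 0 < r \<and> R \<le> \<rho> * r \<and> cball a r \<subseteq> g \<and> g \<subseteq> cball b R) \<and>
     (\<forall>g\<in>S. \<forall>h\<in>S. diameter g \<le> \<sigma> * diameter h)"

text \<open>
  Simple undirected graphs are the symmetric, loop-free digraphs of \<^locale>\<open>pair_graph\<close>.  The vertices
  of an intersection graph are names of the objects, so that a graph given to an algorithm as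
  input carries no geometric information.
\<close>

definition intersection_graph :: "'v pair_pre_digraph \<Rightarrow> 'a set set \<Rightarrow> bool" where
  "intersection_graph G S \<longleftrightarrow> pair_graph G \<and>
     (\<exists>obj. bij_betw obj (pverts G) S \<and>
       (\<forall>u\<in>pverts G. \<forall>v\<in>pverts G. (u, v) \<in> parcs G \<longleftrightarrow> u \<noteq> v \<and> obj u \<inter> obj v \<noteq> {}))"

section \<open>Partitions into few cliques\<close>

definition clique :: "'v pair_pre_digraph \<Rightarrow> 'v set \<Rightarrow> bool" where
  "clique G C \<longleftrightarrow> C \<subseteq> pverts G \<and> (\<forall>u\<in>C. \<forall>v\<in>C. u \<noteq> v \<longrightarrow> (u, v) \<in> parcs G)"

definition kappa_partition :: "nat \<Rightarrow> 'v pair_pre_digraph \<Rightarrow> 'v set set \<Rightarrow> bool" where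
  "kappa_partition \<kappa> G \<P> \<longleftrightarrow> partition_on (pverts G) \<P> \<and>
     (\<forall>W\<in>\<P>. Digraph_Component.connected (with_proj G \<restriction> W) \<and>
       (\<exists>\<C>. finite \<C> \<and> card \<C> \<le> \<kappa> \<and> (\<forall>C\<in>\<C>. clique G C) \<and> W = \<Union>\<C>))"

definition contraction :: "'v pair_pre_digraph \<Rightarrow> 'v set set \<Rightarrow> 'v set pair_pre_digraph" where
  "contraction G \<P> = \<lparr> pverts = \<P>,
     parcs = {(U, W). U \<in> \<P> \<and> W \<in> \<P> \<and> U \<noteq> W \<and> (\<exists>u\<in>U. \<exists>w\<in>W. (u, w) \<in> parcs G)} \<rparr>"

section \<open>Treedepth decompositions\<close>

text \<open>Arcs of a rooted forest point from parent to child.\<close>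

definition rooted_forest :: "'f pair_pre_digraph \<Rightarrow> bool" where
  "rooted_forest F \<longleftrightarrow> pair_fin_digraph F \<and> acyclic (parcs F) \<and>
     (\<forall>u v w. (u, w) \<in> parcs F \<longrightarrow> (v, w) \<in> parcs F \<longrightarrow> u = v)"

definition roots :: "'f pair_pre_digraph \<Rightarrow> 'f set" where
  "roots F = {u \<in> pverts F. \<forall>v. (v, u) \<notin> parcs F}"

definition children :: "'f pair_pre_digraph \<Rightarrow> 'f \<Rightarrow> 'f set" where
  "children F u = {v. (u, v) \<in> parcs F}"

definition treedepth_decomposition ::
    "'a pair_pre_digraph \<Rightarrow> 'f pair_pre_digraph \<Rightarrow> ('f \<Rightarrow> 'a) \<Rightarrow> bool" where
  "treedepth_decomposition H F \<phi> \<longleftrightarrow> rooted_forest F \<and> bij_betw \<phi> (pverts F) (pverts H) \<and>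
     (\<forall>u\<in>pverts F. \<forall>v\<in>pverts F. (\<phi> u, \<phi> v) \<in> parcs H \<longrightarrow>
        (u, v) \<in> (parcs F)\<^sup>+ \<or> (v, u) \<in> (parcs F)\<^sup>+)"

definition root_leaf_paths :: "'f pair_pre_digraph \<Rightarrow> 'f list set" where
  "root_leaf_paths F =
     {p. vwalk p (with_proj F) \<and> hd p \<in> roots F \<and> children F (last p) = {}}"

text \<open>The base of the logarithm only affects constants.\<close>

definition weight :: "('f \<Rightarrow> 'v set) \<Rightarrow> 'f \<Rightarrow> real" where
  "weight \<phi> u = log 2 (1 + real (card (\<phi> u)))"

definition weighted_depth :: "'f pair_pre_digraph \<Rightarrow> ('f \<Rightarrow> 'v set) \<Rightarrow> real" where
  "weighted_depth F \<phi> = Max ((\<lambda>p. \<Sum>u\<leftarrow>p. weight \<phi> u) ` root_leaf_paths F)"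

section \<open>Recursive algorithms on a forest\<close>

record ('v, 'f, 'x) input =
  graph :: "'v pair_pre_digraph"
  dimension :: nat
  part :: "'v set set"
  cgraph :: "'v set pair_pre_digraph"
  forest :: "'f pair_pre_digraph"
  phi :: "'f \<Rightarrow> 'v set"
  aux :: 'x

text \<open>
  Size of an input in words, with vertices, parts and forest nodes referred to by name:
  \<open>phi\<close> is a table with one entry per node, and \<open>aux_size\<close> measures the additional inputs.
\<close>

definition input_size :: "('x \<Rightarrow> nat) \<Rightarrow> ('v, 'f, 'x) input \<Rightarrow> nat" where
  "input_size aux_size x =
     card (pverts (graph x)) + card (parcs (graph x)) + 1 + (\<Sum>W\<in>part x. card W)
     + card (pverts (cgraph x)) + card (parcs (cgraph x))
     + card (pverts (forest x)) + card (parcs (forest x)) + card (pverts (forest x))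
     + aux_size (aux x)"

text \<open>
  A recursive algorithm is a main program together with one recursive procedure whose activations
  belong to forest nodes, in an otherwise arbitrary machine model.  Local memory contents
  have type \<open>'s\<close>, arguments and results of calls have type \<open>'m\<close>.  Depending on its local memory
  and the input, the running activation performs a local step, calls the procedure at a node, or
  returns.  \<open>enter x v m\<close> is the initial local memory of an activation at \<open>v\<close> with argument
  \<open>m\<close>; \<open>resume x s m\<close> is the local memory of the caller after a call has returned \<open>m\<close>.
\<close>

datatype ('f, 's, 'm) action = Local 's | Recurse 'f 'm 's | Return 'm

record ('i, 'f, 's, 'm) rec_alg =
  main :: "'i \<Rightarrow> 's"
  enter :: "'i \<Rightarrow> 'f \<Rightarrow> 'm \<Rightarrow> 's"
  step :: "'i \<Rightarrow> 's \<Rightarrow> ('f, 's, 'm) action"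
  resume :: "'i \<Rightarrow> 's \<Rightarrow> 'm \<Rightarrow> 's"
  mem_size :: "'s \<Rightarrow> nat"

text \<open>
  An activation of the main program has node \<open>None\<close>.  The fields \<open>own_time\<close> (number of steps
  performed by this activation itself, excluding the activations it calls) and \<open>calls\<close> (nodes
  called so far) only record resource usage; the algorithm cannot read them.
\<close>

record ('f, 's) frame =
  node :: "'f option"
  memory :: 's
  own_time :: nat
  calls :: "'f list"

datatype ('f, 's, 'm) config = Running "('f, 's) frame" "('f, 's) frame list" | Halted 'm

fun advance :: "('i, 'f, 's, 'm) rec_alg \<Rightarrow> 'i \<Rightarrow> ('f, 's, 'm) config \<Rightarrow> ('f, 's, 'm) config" where
  "advance A x (Halted m) = Halted m"
| "advance A x (Running fr stack) = (case step A x (memory fr) of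
     Local s \<Rightarrow> Running (fr\<lparr>memory := s, own_time := own_time fr + 1\<rparr>) stack
   | Recurse v m s \<Rightarrow>
       Running \<lparr>node = Some v, memory = enter A x v m, own_time = 0, calls = []\<rparr>
         (fr\<lparr>memory := s, own_time := own_time fr + 1, calls := v # calls fr\<rparr> # stack)
   | Return m \<Rightarrow> (case stack of [] \<Rightarrow> Halted m
       | caller # rest \<Rightarrow> Running (caller\<lparr>memory := resume A x (memory caller) m\<rparr>) rest))"

definition start :: "('i, 'f, 's, 'm) rec_alg \<Rightarrow> 'i \<Rightarrow> ('f, 's, 'm) config" where
  "start A x = Running \<lparr>node = None, memory = main A x, own_time = 0, calls = []\<rparr> []"

definition config_at :: "('i, 'f, 's, 'm) rec_alg \<Rightarrow> 'i \<Rightarrow> nat \<Rightarrow> ('f, 's, 'm) config" where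
  "config_at A x t = (advance A x ^^ t) (start A x)"

fun frames :: "('f, 's, 'm) config \<Rightarrow> ('f, 's) frame list" where
  "frames (Running fr stack) = fr # stack"
| "frames (Halted m) = []"

definition activations :: "('i, 'f, 's, 'm) rec_alg \<Rightarrow> 'i \<Rightarrow> ('f, 's) frame set" where
  "activations A x = (\<Union>t. set (frames (config_at A x t)))"

definition halts_within :: "('i, 'f, 's, 'm) rec_alg \<Rightarrow> 'i \<Rightarrow> real \<Rightarrow> bool" where
  "halts_within A x T \<longleftrightarrow> (\<exists>t m. real t \<le> T \<and> config_at A x t = Halted m)"

definition space_at ::
    "('x \<Rightarrow> nat) \<Rightarrow> (('v, 'f, 'x) input, 'f, 's, 'm) rec_alg \<Rightarrow> ('v, 'f, 'x) input \<Rightarrow> nat \<Rightarrow> nat" where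
  "space_at aux_size A x t =
     input_size aux_size x + (\<Sum>fr\<leftarrow>frames (config_at A x t). mem_size A (memory fr))"

definition callees :: "'f pair_pre_digraph \<Rightarrow> 'f option \<Rightarrow> 'f set" where
  "callees F w = (case w of None \<Rightarrow> roots F | Some u \<Rightarrow> children F u)"

text \<open>
  The family \<open>X\<close> of inputs is the range of the asymptotic notation, \<open>n\<close> its parameter: an
  \<open>O\<close>-constant is uniform over \<open>X\<close> and over all nodes.  With \<open>w\<close> the weight of \<open>u\<close>, the second
  and third conjuncts are the time bounds \<open>n^O(1)\<close> for the main program (which calls the roots) and
  \<open>2^O(w) * n^O(1)\<close> at node \<open>u\<close>, where \<open>own_time\<close> excludes the recursive calls.  The factor \<open>k\<close> in \<open>k * n ^ k\<close> accounts for
  \<open>n = 1\<close>.  The number of recursive calls is bounded for every child separately, as needed for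
  procedures that recurse on all children of a node; this is implied by a bound on
  the total number of calls.
\<close>

definition uses_forest ::
    "(('v, 'f, 'x) input, 'f, 's, 'm) rec_alg \<Rightarrow> ('v, 'f, 'x) input set
       \<Rightarrow> (('v, 'f, 'x) input \<Rightarrow> nat) \<Rightarrow> bool" where
  "uses_forest A X n \<longleftrightarrow>
     (\<forall>x\<in>X. \<forall>fr\<in>activations A x. set (calls fr) \<subseteq> callees (forest x) (node fr)) \<and>
     (\<exists>k::nat. \<forall>x\<in>X. \<forall>fr\<in>activations A x. node fr = None \<longrightarrow> own_time fr \<le> k * n x ^ k) \<and>
     (\<exists>(c::real) (k::nat). \<forall>x\<in>X. \<forall>fr\<in>activations A x. \<forall>u. node fr = Some u \<longrightarrow>
        real (own_time fr) \<le> 2 powr (c * weight (phi x) u) * (k * real (n x) ^ k)) \<and>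
     (\<exists>c::real. \<forall>x\<in>X. \<forall>fr\<in>activations A x. \<forall>u. node fr = Some u \<longrightarrow>
        (\<forall>v. real (count_list (calls fr) v) \<le> 2 powr (c * weight (phi x) u))) \<and>
     (\<exists>k::nat. \<forall>x\<in>X. \<forall>fr\<in>activations A x. mem_size A (memory fr) \<le> k * n x ^ k)"

end

theory Submission
  imports Defs
begin

text \<open>
  Consider the work still to be done by all activations on the call stack, assuming that each of them
  exhausts its own time bound and its number of calls to every callee.  This potential drops by at
  least one in every step, so the running time is at most the worst-case cost of the main program.
  A call at \<open>u\<close> costs at most the sum, over the descendants \<open>v\<close> of \<open>u\<close>, of the time spent at \<open>v\<close> times
  the product of the branching factors \<open>2 powr O(\<omega>)\<close> between them; along a path this product is \<open>2\<close> to
  the power \<open>O\<close> of its weight, and hence governed by the weighted depth.  The polynomial factors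
  disappear in \<open>2\<close> to the power \<open>O(n\<^sup>a)\<close> because \<open>a = 1 - 1/d > 0\<close>.  The call stack is a path of
  the forest, which has at most \<open>n\<close> nodes, so polynomial space per activation suffices.
\<close>

section \<open>Rooted forests\<close>

abbreviation ancestors :: "'f pair_pre_digraph \<Rightarrow> 'f \<Rightarrow> 'f set" where
  "ancestors F u \<equiv> {v. (v, u) \<in> (parcs F)\<^sup>*}"

abbreviation descendants :: "'f pair_pre_digraph \<Rightarrow> 'f \<Rightarrow> 'f set" where
  "descendants F u \<equiv> {v. (u, v) \<in> (parcs F)\<^sup>*}"

lemma rooted_forestD:
  assumes "rooted_forest F"
  shows rooted_forest_finite: "finite (pverts F)"
    and rooted_forest_finite_arcs: "finite (parcs F)"
    and rooted_forest_acyclic: "acyclic (parcs F)"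
    and rooted_forest_parent_unique: "(u, w) \<in> parcs F \<Longrightarrow> (v, w) \<in> parcs F \<Longrightarrow> u = v"
    and rooted_forest_arcs: "parcs F \<subseteq> pverts F \<times> pverts F"
proof -
  interpret pair_fin_digraph F
    using assms by (simp add: rooted_forest_def)
  show "finite (pverts F)" "finite (parcs F)"
    by (rule pair_finite_verts, rule pair_finite_arcs)
  show "parcs F \<subseteq> pverts F \<times> pverts F"
    using arc_fst_in_verts arc_snd_in_verts by force
  show "acyclic (parcs F)" "(u, w) \<in> parcs F \<Longrightarrow> (v, w) \<in> parcs F \<Longrightarrow> u = v"
    using assms unfolding rooted_forest_def by blast+
qed

lemma ancestors_subset:
  assumes "rooted_forest F" "u \<in> pverts F"
  shows "ancestors F u \<subseteq> pverts F"
  using rooted_forest_arcs[OF assms(1)] assms(2) by (blast dest: rtranclD tranclD)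

lemma descendants_subset:
  assumes "rooted_forest F" "u \<in> pverts F"
  shows "descendants F u \<subseteq> pverts F"
  using rooted_forest_arcs[OF assms(1)] assms(2) by (blast dest: rtranclD tranclD2)

lemma callees_subset:
  assumes "rooted_forest F"
  shows "callees F w \<subseteq> pverts F"
  using rooted_forest_arcs[OF assms]
  by (auto simp: callees_def roots_def children_def split: option.splits)

lemma finite_callees: "rooted_forest F \<Longrightarrow> finite (callees F w)"
  using callees_subset rooted_forest_finite finite_subset by metis

lemma finite_descendants:
  assumes "rooted_forest F" "u \<in> pverts F"
  shows "finite (descendants F u)"
  by (rule finite_subset[OF descendants_subset[OF assms] rooted_forest_finite[OF assms(1)]])

lemma finite_ancestors:
  assumes "rooted_forest F" "u \<in> pverts F"
  shows "finite (ancestors F u)"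
  by (rule finite_subset[OF ancestors_subset[OF assms] rooted_forest_finite[OF assms(1)]])

lemma ancestors_root: "v \<in> roots F \<Longrightarrow> ancestors F v = {v}"
  by (auto simp: roots_def dest: rtranclD tranclD2)

text \<open>The last arc of a path into \<open>v\<close> starts at its only parent \<open>u\<close>;
  a path from \<open>v\<close> to \<open>u\<close> would close a cycle.\<close>

lemma ancestors_child:
  assumes "rooted_forest F" "v \<in> children F u"
  shows "ancestors F v = insert v (ancestors F u)" "v \<notin> ancestors F u"
proof -
  have uv: "(u, v) \<in> parcs F"
    using assms(2) by (simp add: children_def)
  show "ancestors F v = insert v (ancestors F u)"
  proof
    show "ancestors F v \<subseteq> insert v (ancestors F u)"
      using rooted_forest_parent_unique[OF assms(1) uv] by (blast dest: rtranclD tranclD2)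
    show "insert v (ancestors F u) \<subseteq> ancestors F v"
      using uv by auto
  qed
  show "v \<notin> ancestors F u"
    using rooted_forest_acyclic[OF assms(1)] uv
    by (metis acyclic_def mem_Collect_eq rtrancl_into_trancl2)
qed

text \<open>Since parents are unique, two paths into \<open>z\<close> share their last arc unless
  one of them is empty. The induction walks back along both.\<close>

lemma ancestors_linear:
  assumes "rooted_forest F" "(v, z) \<in> (parcs F)\<^sup>*" "(w, z) \<in> (parcs F)\<^sup>*"
  shows "(v, w) \<in> (parcs F)\<^sup>* \<or> (w, v) \<in> (parcs F)\<^sup>*"
  using assms(2,3)
proof (induction z arbitrary: w rule: rtrancl_induct)
  case base
  then show ?case by blast
next
  case (step y z)
  from step.prems show ?case
  proof (cases rule: rtranclE)
    case base
    then show ?thesis using step.hyps by auto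
  next
    case (step y')
    then have "y' = y"
      using rooted_forest_parent_unique[OF assms(1)] \<open>(y, z) \<in> parcs F\<close> by blast
    then show ?thesis using step step.IH by blast
  qed
qed

text \<open>A common descendant would make \<open>v\<close> and \<open>w\<close> comparable. But a
  root has no ancestor besides itself, and a proper ancestor of a child of \<open>u\<close> is an
  ancestor of \<open>u\<close>, so one of two comparable siblings would lie above its own
  parent.\<close>

lemma descendants_disjoint_callees:
  assumes "rooted_forest F" "v \<in> callees F r" "w \<in> callees F r" "v \<noteq> w"
  shows "descendants F v \<inter> descendants F w = {}"
proof -
  have no: "(v, w) \<notin> (parcs F)\<^sup>*"
    if "v \<in> callees F r" "w \<in> callees F r" "v \<noteq> w" for v w
  proof (cases r)
    case None
    then show ?thesis
      using ancestors_root[of w F] that by (auto simp: callees_def)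
  next
    case (Some u)
    then have c: "v \<in> children F u" "w \<in> children F u"
      using that by (auto simp: callees_def)
    then show ?thesis
      using ancestors_child[OF assms(1)] that(3) by blast
  qed
  show ?thesis
    using no[OF assms(2,3,4)] no[OF assms(3,2)] assms(4) ancestors_linear[OF assms(1)] by blast
qed

section \<open>Sizes of subtrees\<close>

lemma sum_card_descendants:
  assumes "rooted_forest F"
  shows "(\<Sum>v\<in>callees F r. card (descendants F v)) = card (\<Union>v\<in>callees F r. descendants F v)"
proof (rule card_UN_disjoint[symmetric])
  show "finite (callees F r)"
    by (rule finite_callees[OF assms])
  show "\<forall>v\<in>callees F r. finite (descendants F v)"
    using callees_subset[OF assms] finite_descendants[OF assms] by blast
qed (use descendants_disjoint_callees[OF assms] in blast)

lemma sum_card_descendants_roots: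
  assumes "rooted_forest F"
  shows "(\<Sum>v\<in>callees F None. card (descendants F v)) \<le> card (pverts F)"
  unfolding sum_card_descendants[OF assms]
  using callees_subset[OF assms] descendants_subset[OF assms] rooted_forest_finite[OF assms]
  by (intro card_mono) blast+

text \<open>The summand 1 stands for \<open>u\<close> itself; in the cost bound it pays for the own
  time spent at \<open>u\<close>.\<close>

lemma sum_card_descendants_children:
  assumes "rooted_forest F" "u \<in> pverts F"
  shows "1 + (\<Sum>v\<in>callees F (Some u). card (descendants F v)) \<le> card (descendants F u)"
proof -
  let ?D = "\<Union>v\<in>callees F (Some u). descendants F v"
  have fin: "finite (descendants F u)"
    by (rule finite_descendants[OF assms])
  have "u \<notin> ?D"
    using ancestors_child(2)[OF assms(1)] by (auto simp: callees_def)
  moreover have sub: "insert u ?D \<subseteq> descendants F u"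
    by (auto simp: callees_def children_def)
  ultimately have "card (insert u ?D) = 1 + card ?D"
    using fin by (subst card_insert_disjoint) (auto intro: finite_subset)
  then show ?thesis
    unfolding sum_card_descendants[OF assms(1)] using card_mono[OF fin sub] by simp
qed

subsection \<open>Weights of root-to-node paths\<close>

lemma vwalk_append_arc:
  assumes "rooted_forest F" "vwalk p (with_proj F)" "(last p, v) \<in> parcs F"
  shows "vwalk (p @ [v]) (with_proj F)"
proof -
  have "set (vwalk_arcs (p @ [v])) \<subseteq> insert (last p, v) (set (vwalk_arcs p))"
    by (induction p rule: vwalk_arcs.induct) auto
  then show ?thesis
    using assms rooted_forest_arcs[OF assms(1)]
    by (auto simp: vwalk_def)
qed

lemma vwalk_distinct:
  assumes "acyclic (parcs F)" "vwalk p (with_proj F)"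
  shows "distinct p"
proof -
  \<comment> \<open>\<open>sorted_wrt\<close> relates all pairs of positions, hence the transitive
    closure; its irreflexivity then excludes repetitions.\<close>
  have "set (vwalk_arcs p) \<subseteq> parcs F \<Longrightarrow> sorted_wrt (\<lambda>u v. (u, v) \<in> (parcs F)\<^sup>+) p"
  proof (induction p rule: vwalk_arcs.induct)
    case (3 x y xs)
    then show ?case
      using trancl_into_trancl2[of x y "parcs F"] by auto
  qed auto
  then have "sorted_wrt (\<lambda>u v. (u, v) \<in> (parcs F)\<^sup>+) p"
    using assms(2) by (auto simp: vwalk_def)
  then show ?thesis
    using assms(1) by (induction p) (auto simp: acyclic_def)
qed

text \<open>Finiteness makes the \<open>Max\<close> in \<open>weighted_depth\<close> an upper bound.
  It holds because walks in an acyclic graph do not repeat vertices.\<close>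

lemma finite_root_leaf_paths:
  assumes "rooted_forest F"
  shows "finite (root_leaf_paths F)"
proof (rule finite_subset)
  show "root_leaf_paths F \<subseteq> {p. set p \<subseteq> pverts F \<and> distinct p}"
    using vwalk_distinct[OF rooted_forest_acyclic[OF assms]]
    by (auto simp: root_leaf_paths_def vwalk_def)
  show "finite {p. set p \<subseteq> pverts F \<and> distinct p}"
    by (rule finite_subset_distinct[OF rooted_forest_finite[OF assms]])
qed

lemma weight_nonneg: "weight \<phi> u \<ge> 0"
  by (simp add: weight_def)

text \<open>Weights are nonnegative, so prolonging a walk never decreases its weight, and by
  finiteness and acyclicity it can be prolonged to a leaf. Formally this is well-founded induction
  on the last vertex along reversed arcs.\<close>

lemma walk_weight_le_weighted_depth:
  assumes F: "rooted_forest F" and "vwalk p (with_proj F)" "hd p \<in> roots F"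
  shows "(\<Sum>u\<leftarrow>p. weight \<phi> u) \<le> weighted_depth F \<phi>"
proof -
  have wf: "wf ((parcs F)\<inverse>)"
    by (rule finite_acyclic_wf_converse[OF rooted_forest_finite_arcs[OF F] rooted_forest_acyclic[OF F]])
  have "\<forall>p. last p = u \<longrightarrow> vwalk p (with_proj F) \<longrightarrow> hd p \<in> roots F \<longrightarrow>
          (\<Sum>u\<leftarrow>p. weight \<phi> u) \<le> weighted_depth F \<phi>" for u
    using wf
  proof (induction u rule: wf_induct_rule)
    case (less u)
    show ?case
    proof (intro allI impI)
      fix p assume p: "last p = u" "vwalk p (with_proj F)" "hd p \<in> roots F"
      show "(\<Sum>u\<leftarrow>p. weight \<phi> u) \<le> weighted_depth F \<phi>"
      proof (cases "children F u = {}")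
        case True
        then have "p \<in> root_leaf_paths F"
          using p by (simp add: root_leaf_paths_def)
        then show ?thesis
          unfolding weighted_depth_def using finite_root_leaf_paths[OF F] by (intro Max_ge) auto
      next
        case False
        then obtain v where v: "(u, v) \<in> parcs F"
          by (auto simp: children_def)
        have "p \<noteq> []"
          using p by (auto simp: vwalk_def)
        then have "(\<Sum>u\<leftarrow>p @ [v]. weight \<phi> u) \<le> weighted_depth F \<phi>"
          using less[of v] v p vwalk_append_arc[OF F p(2), of v]
          by (metis converse_iff hd_append2 last_snoc)
        then show ?thesis
          using weight_nonneg[of \<phi> v] by simp
      qed
    qed
  qed
  then show ?thesis using assms by blast
qed

text \<open>The ancestors of \<open>u\<close> form a walk from a root to \<open>u\<close>, built by
  well-founded induction from the walk to the parent.\<close>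

lemma sum_weight_ancestors_le:
  assumes F: "rooted_forest F" and "u \<in> pverts F"
  shows "(\<Sum>v\<in>ancestors F u. weight \<phi> v) \<le> weighted_depth F \<phi>"
proof -
  have wf: "wf (parcs F)"
    by (rule finite_acyclic_wf[OF rooted_forest_finite_arcs[OF F] rooted_forest_acyclic[OF F]])
  have "u \<in> pverts F \<longrightarrow> (\<exists>p. vwalk p (with_proj F) \<and> hd p \<in> roots F \<and> last p = u \<and>
          (\<Sum>v\<leftarrow>p. weight \<phi> v) = (\<Sum>v\<in>ancestors F u. weight \<phi> v))"
    using wf
  proof (induction u rule: wf_induct_rule)
    case (less u)
    show ?case
    proof (cases "u \<in> roots F")
      case True
      then show ?thesis
        unfolding ancestors_root[OF True] by (intro impI exI[of _ "[u]"]) (auto simp: vwalk_def)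
    next
      case False
      show ?thesis
      proof
        assume "u \<in> pverts F"
        with False obtain v where v: "(v, u) \<in> parcs F"
          by (auto simp: roots_def)
        then have u: "u \<in> children F v" and vF: "v \<in> pverts F"
          using rooted_forest_arcs[OF F] by (auto simp: children_def)
        obtain p where p: "vwalk p (with_proj F)" "hd p \<in> roots F" "last p = v"
            "(\<Sum>v\<leftarrow>p. weight \<phi> v) = (\<Sum>v\<in>ancestors F v. weight \<phi> v)"
          using less[OF v] vF by blast
        have "p \<noteq> []"
          using p by (auto simp: vwalk_def)
        moreover have "vwalk (p @ [u]) (with_proj F)"
          using vwalk_append_arc[OF F p(1)] p(3) v by simp
        moreover have "(\<Sum>v\<in>ancestors F u. weight \<phi> v)
            = weight \<phi> u + (\<Sum>v\<in>ancestors F v. weight \<phi> v)"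
          unfolding ancestors_child(1)[OF F u]
          using ancestors_child(2)[OF F u] finite_ancestors[OF F vF] by simp
        ultimately show "\<exists>p. vwalk p (with_proj F) \<and> hd p \<in> roots F \<and> last p = u \<and>
          (\<Sum>v\<leftarrow>p. weight \<phi> v) = (\<Sum>v\<in>ancestors F u. weight \<phi> v)"
          using p by (intro exI[of _ "p @ [u]"]) auto
      qed
    qed
  qed
  then show ?thesis
    using walk_weight_le_weighted_depth[OF F] assms(2) by metis
qed

section \<open>Running time and stack of a recursive algorithm\<close>

lemma config_at_0: "config_at A x 0 = start A x"
  and config_at_Suc: "config_at A x (Suc t) = advance A x (config_at A x t)"
  by (simp_all add: config_at_def)

lemma frames_config_at: "fr \<in> set (frames (config_at A x t)) \<Longrightarrow> fr \<in> activations A x"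
  by (auto simp: activations_def)

text \<open>Every call is a step of the caller. For the main program this turns the time bound into
  a bound on the number of calls, which \<open>uses_forest\<close> does not state
  separately.\<close>

lemma length_calls_le_own_time:
  assumes "fr \<in> activations A x"
  shows "length (calls fr) \<le> own_time fr"
proof -
  have "\<forall>fr\<in>set (frames (config_at A x t)). length (calls fr) \<le> own_time fr" for t
  proof (induction t)
    case 0
    then show ?case by (simp add: config_at_0 start_def)
  next
    case (Suc t)
    then show ?case
      by (cases "config_at A x t")
        (auto simp: config_at_Suc split: action.splits list.splits)
  qed
  then show ?thesis using assms by (auto simp: activations_def)
qed

text \<open>
  The work still to be done in an activation: \<open>own\<close> and \<open>cnt\<close> bound the own time and the number
  of calls to each callee, and \<open>B v\<close> is an upper bound for the whole cost of a call at \<open>v\<close>.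
\<close>

definition frame_potential ::
    "'f pair_pre_digraph \<Rightarrow> ('f option \<Rightarrow> real) \<Rightarrow> ('f option \<Rightarrow> real) \<Rightarrow> ('f \<Rightarrow> real)
       \<Rightarrow> ('f, 's) frame \<Rightarrow> real" where
  "frame_potential F own cnt B fr = own (node fr) - real (own_time fr) + 1 +
     (\<Sum>v\<in>callees F (node fr). (cnt (node fr) - real (count_list (calls fr) v)) * B v)"

definition within_bounds ::
    "'f pair_pre_digraph \<Rightarrow> ('f option \<Rightarrow> real) \<Rightarrow> ('f option \<Rightarrow> real) \<Rightarrow> ('f, 's) frame \<Rightarrow> bool" where
  "within_bounds F own cnt fr \<longleftrightarrow> set (calls fr) \<subseteq> callees F (node fr) \<and>
     real (own_time fr) \<le> own (node fr) \<and> (\<forall>v. real (count_list (calls fr) v) \<le> cnt (node fr))"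

text \<open>The remaining 1 is reserved for the \<open>Return\<close> step, which
  \<open>own_time\<close> does not count.\<close>

lemma frame_potential_ge_1:
  assumes "within_bounds F own cnt fr" "\<And>v. B v \<ge> 0"
  shows "frame_potential F own cnt B fr \<ge> 1"
proof -
  have "(\<Sum>v\<in>callees F (node fr). (cnt (node fr) - real (count_list (calls fr) v)) * B v) \<ge> 0"
    using assms by (intro sum_nonneg mult_nonneg_nonneg) (auto simp: within_bounds_def)
  then show ?thesis
    using assms(1) by (simp add: frame_potential_def within_bounds_def)
qed

text \<open>The caller gives up 1 for the step and \<open>B v\<close> for one of its calls to
  \<open>v\<close>; the latter becomes the budget of the new activation.\<close>

lemma frame_potential_call:
  assumes "finite (callees F (node fr))" "v \<in> callees F (node fr)"
  shows "frame_potential F own cnt B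
      (fr\<lparr>memory := s, own_time := own_time fr + 1, calls := v # calls fr\<rparr>)
    = frame_potential F own cnt B fr - 1 - B v"
proof -
  let ?k = "cnt (node fr)" and ?c = "\<lambda>w. real (count_list (calls fr) w)"
  have "(\<Sum>w\<in>callees F (node fr). (?k - real (count_list (v # calls fr) w)) * B w)
      = (\<Sum>w\<in>callees F (node fr). (?k - ?c w) * B w - (if v = w then B w else 0))"
    by (intro sum.cong) (auto simp: algebra_simps)
  also have "\<dots> = (\<Sum>w\<in>callees F (node fr). (?k - ?c w) * B w) - B v"
    using assms by (simp add: sum_subtractf)
  finally show ?thesis
    by (simp add: frame_potential_def)
qed

text \<open>A local step consumes own time. A call releases \<open>1 + B v\<close>, of which the new
  frame takes at most \<open>B v\<close> by \<open>B_rec\<close>. A return removes a frame of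
  potential at least 1 and changes only the memory of the caller.\<close>

lemma config_potential_decreases:
  fixes A :: "('i, 'f, 's, 'm) rec_alg" and B :: "'f \<Rightarrow> real"
  assumes wb: "\<forall>f\<in>set (fr # st) \<union> set (frames (advance A x (Running fr st))). within_bounds F own cnt f"
    and fin: "\<And>w. finite (callees F w)"
    and B: "\<And>v. B v \<ge> 0"
    and B_rec: "\<And>v. v \<in> pverts F \<Longrightarrow>
      own (Some v) + 1 + cnt (Some v) * (\<Sum>w\<in>callees F (Some v). B w) \<le> B v"
    and sub: "\<And>w. callees F w \<subseteq> pverts F"
  shows "(\<Sum>f\<leftarrow>frames (advance A x (Running fr st)). frame_potential F own cnt B f) + 1
      \<le> (\<Sum>f\<leftarrow>fr # st. frame_potential F own cnt B f)"
proof (cases "step A x (memory fr)")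
  case (Local s)
  then show ?thesis by (simp add: frame_potential_def)
next
  case (Recurse v m s)
  let ?new = "\<lparr>node = Some v, memory = enter A x v m, own_time = 0, calls = []\<rparr> :: ('f, 's) frame"
  \<comment> \<open>The call is already recorded in the caller's frame of the next configuration, so
    the bounds assumed there apply to \<open>v\<close>.\<close>
  have v: "v \<in> callees F (node fr)"
    using wb Recurse by (simp add: within_bounds_def)
  have "frame_potential F own cnt B ?new \<le> B v"
    using B_rec[of v] v sub by (auto simp: frame_potential_def sum_distrib_left)
  then show ?thesis
    using frame_potential_call[OF fin v, of own cnt B s] Recurse by simp
next
  case (Return m)
  have "frame_potential F own cnt B fr \<ge> 1"
    by (rule frame_potential_ge_1) (use wb B in auto)
  then show ?thesis
    using Return by (cases st) (auto simp: frame_potential_def)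
qed

text \<open>The stated time is the potential of the initial configuration. The potential drops by at
  least 1 per step and is at least 1 as long as the algorithm runs.\<close>

lemma halts_within_recursive_bound:
  fixes A :: "('i, 'f, 's, 'm) rec_alg" and B :: "'f \<Rightarrow> real"
  assumes wb: "\<And>fr. fr \<in> activations A x \<Longrightarrow> within_bounds F own cnt fr"
    and fin: "\<And>w. finite (callees F w)"
    and B: "\<And>v. B v \<ge> 0"
    and B_rec: "\<And>v. v \<in> pverts F \<Longrightarrow>
      own (Some v) + 1 + cnt (Some v) * (\<Sum>w\<in>callees F (Some v). B w) \<le> B v"
    and sub: "\<And>w. callees F w \<subseteq> pverts F"
  shows "halts_within A x (own None + 1 + cnt None * (\<Sum>v\<in>callees F None. B v))"
proof -
  define T where "T = own None + 1 + cnt None * (\<Sum>v\<in>callees F None. B v)"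
  let ?\<Phi> = "\<lambda>t. \<Sum>f\<leftarrow>frames (config_at A x t). frame_potential F own cnt B f"
  \<comment> \<open>After halting the potential stays 0 while \<open>t\<close> keeps growing, so the
    inequality is claimed only up to that point.\<close>
  have decr: "(\<exists>i\<le>t. \<exists>m. config_at A x i = Halted m) \<or> ?\<Phi> t + real t \<le> T" for t
  proof (induction t)
    case 0
    then show ?case
      by (simp add: config_at_0 start_def frame_potential_def sum_distrib_left T_def)
  next
    case (Suc t)
    show ?case
    proof (cases "config_at A x t")
      case (Running fr st)
      have "\<forall>f\<in>set (fr # st) \<union> set (frames (advance A x (Running fr st))). within_bounds F own cnt f"
        using wb frames_config_at[of _ A x t] frames_config_at[of _ A x "Suc t"] Running
        by (auto simp: config_at_Suc)
      from config_potential_decreases[OF this fin B B_rec sub]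
      have "?\<Phi> (Suc t) + 1 \<le> ?\<Phi> t"
        using Running by (simp add: config_at_Suc)
      then show ?thesis using Suc le_SucI by fastforce
    qed (use le_SucI in blast)
  qed
  show ?thesis
  proof (rule ccontr)
    assume neg: "\<not> ?thesis"
    \<comment> \<open>This keeps \<open>nat\<close> from truncating a negative floor below.\<close>
    have pos: "1 \<le> T"
    proof -
      have "frame_potential F own cnt B \<lparr>node = None, memory = main A x, own_time = 0, calls = []\<rparr> \<ge> 1"
        using frames_config_at[of _ A x 0]
        by (intro frame_potential_ge_1 wb B) (simp add: config_at_0 start_def)
      then show ?thesis by (simp add: frame_potential_def T_def sum_distrib_left)
    qed
    \<comment> \<open>The last integer time not exceeding \<open>T\<close>: if the algorithm still
      ran then, a potential of at least 1 would give \<open>t + 1 \<le> T\<close>.\<close>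
    define t where "t = nat \<lfloor>T\<rfloor>"
    have t: "real t \<le> T" "T < real t + 1"
      using pos by (auto simp: t_def)
    have running: "config_at A x i \<noteq> Halted m" if "i \<le> t" for i m
      using neg that t(1) unfolding halts_within_def T_def by fastforce
    then obtain fr st where c: "config_at A x t = Running fr st"
      by (metis config.exhaust order_refl)
    have "?\<Phi> t \<ge> 1"
    proof -
      have ge: "frame_potential F own cnt B f \<ge> 1" if "f \<in> set (fr # st)" for f
        using frames_config_at[of f A x t] c that by (intro frame_potential_ge_1 wb B) auto
      have "(\<Sum>f\<leftarrow>st. frame_potential F own cnt B f) \<ge> 0"
        using ge by (intro sum_list_nonneg) fastforce
      then show ?thesis using ge[of fr] c by simp
    qed
    then show False
      using decr[of t] running t(2) by force
  qed
qed

section \<open>The call stack as a path of the forest\<close>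

fun call_chain :: "('f, 's) frame list \<Rightarrow> bool" where
  "call_chain [] \<longleftrightarrow> True"
| "call_chain [fr] \<longleftrightarrow> node fr = None"
| "call_chain (fr # caller # st) \<longleftrightarrow>
     (\<exists>v\<in>set (calls caller). node fr = Some v) \<and> call_chain (caller # st)"

lemma call_chain_cong:
  assumes "call_chain (fr # st)" "node fr' = node fr" "set (calls fr) \<subseteq> set (calls fr')"
  shows "call_chain (fr' # st)"
  using assms by (cases st) auto

text \<open>A step keeps the node of the top frame, or pushes a frame whose node has just been
  recorded by its caller, or pops the top frame.\<close>

lemma call_chain_config_at: "call_chain (frames (config_at A x t))"
proof (induction t)
  case 0
  then show ?case by (simp add: config_at_0 start_def)
next
  case (Suc t)
  show ?case
  proof (cases "config_at A x t")
    case (Running fr st)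
    then have chain: "call_chain (fr # st)"
      using Suc by simp
    show ?thesis
    proof (cases "step A x (memory fr)")
      case Local
      then show ?thesis
        using Running call_chain_cong[OF chain] by (simp add: config_at_Suc)
    next
      case Recurse
      then show ?thesis
        using Running by (simp add: config_at_Suc) (rule call_chain_cong[OF chain]; auto)
    next
      case (Return m)
      show ?thesis
      proof (cases st)
        case Nil
        then show ?thesis using Running Return by (simp add: config_at_Suc)
      next
        case (Cons caller rest)
        then have "call_chain (caller # rest)"
          using chain by simp
        then show ?thesis
          using Running Return Cons call_chain_cong by (fastforce simp: config_at_Suc)
      qed
    qed
  qed (simp add: config_at_Suc)
qed

text \<open>Going up the stack, each node is a root or a child of the node of the frame below, so
  every further frame adds exactly one new ancestor.\<close>

lemma length_call_chain:
  assumes F: "rooted_forest F"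
    and "\<And>f. f \<in> set (fr # st) \<Longrightarrow> set (calls f) \<subseteq> callees F (node f)"
    and "call_chain (fr # st)"
  shows "length st \<le> (case node fr of None \<Rightarrow> 0 | Some v \<Rightarrow> card (ancestors F v))"
  using assms(2,3)
proof (induction st arbitrary: fr)
  case Nil
  then show ?case by simp
next
  case (Cons caller st)
  then obtain v where v: "v \<in> set (calls caller)" "node fr = Some v"
    by auto
  have call: "v \<in> callees F (node caller)"
    using Cons.prems(1)[of caller] v(1) by auto
  have len: "length st \<le> (case node caller of None \<Rightarrow> 0 | Some v \<Rightarrow> card (ancestors F v))"
    using Cons.prems by (intro Cons.IH) auto
  show ?case
  proof (cases "node caller")
    case None
    then show ?thesis
      using len v call ancestors_root[of v F] by (simp add: callees_def)
  next
    case (Some u)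
    then have u: "v \<in> children F u"
      using call by (simp add: callees_def)
    then have "u \<in> pverts F"
      using rooted_forest_arcs[OF F] by (auto simp: children_def)
    then have "card (ancestors F v) = Suc (card (ancestors F u))"
      unfolding ancestors_child(1)[OF F u]
      using ancestors_child(2)[OF F u] finite_ancestors[OF F] by (intro card_insert_disjoint) auto
    then show ?thesis
      using len v Some by simp
  qed
qed

text \<open>The additional frame is that of the main program, which belongs to no node.\<close>

lemma length_frames_le:
  assumes F: "rooted_forest F"
    and calls: "\<And>fr. fr \<in> activations A x \<Longrightarrow> set (calls fr) \<subseteq> callees F (node fr)"
  shows "length (frames (config_at A x t)) \<le> card (pverts F) + 1"
proof (cases "frames (config_at A x t)")
  case Nil
  then show ?thesis by simp
next
  case (Cons fr st)
  have c: "set (calls f) \<subseteq> callees F (node f)" if "f \<in> set (fr # st)" for f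
    using that frames_config_at[of f A x t] Cons calls by auto
  have chain: "call_chain (fr # st)"
    using call_chain_config_at[of A x t] Cons by simp
  have "card (ancestors F v) \<le> card (pverts F)" if "node fr = Some v" for v
  proof -
    have "v \<in> pverts F"
      using chain c callees_subset[OF F] that by (cases st) fastforce+
    then show ?thesis
      by (intro card_mono ancestors_subset F rooted_forest_finite)
  qed
  then show ?thesis
    using length_call_chain[OF F c chain] Cons by (fastforce split: option.splits)
qed

subsection \<open>The cost of a call\<close>

text \<open>
  The part of the weighted depth that is not used up by the proper ancestors of \<open>u\<close> bounds every
  downward path from \<open>u\<close>, and \<open>descendants F u\<close> counts the end points of these paths.
\<close>

definition call_cost ::
    "'f pair_pre_digraph \<Rightarrow> ('f \<Rightarrow> 'v set) \<Rightarrow> real \<Rightarrow> real \<Rightarrow> 'f \<Rightarrow> real" where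
  "call_cost F \<phi> c p u = (p + 1) *
     2 powr (c * (weighted_depth F \<phi> - (\<Sum>v\<in>ancestors F u - {u}. weight \<phi> v))) *
     real (card (descendants F u))"

lemma call_cost_nonneg: "p \<ge> 0 \<Longrightarrow> call_cost F \<phi> c p u \<ge> 0"
  by (simp add: call_cost_def)

lemma sum_call_cost_roots_le:
  assumes F: "rooted_forest F" and "p \<ge> 0"
  shows "(\<Sum>v\<in>callees F None. call_cost F \<phi> c p v)
    \<le> (p + 1) * 2 powr (c * weighted_depth F \<phi>) * real (card (pverts F))"
proof -
  have "(\<Sum>v\<in>callees F None. call_cost F \<phi> c p v)
      = (\<Sum>v\<in>callees F None. (p + 1) * 2 powr (c * weighted_depth F \<phi>) * real (card (descendants F v)))"
    by (intro sum.cong) (simp_all add: callees_def call_cost_def ancestors_root)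
  also have "\<dots> = (p + 1) * 2 powr (c * weighted_depth F \<phi>)
      * real (\<Sum>v\<in>callees F None. card (descendants F v))"
    by (simp add: sum_distrib_left)
  also have "\<dots> \<le> (p + 1) * 2 powr (c * weighted_depth F \<phi>) * real (card (pverts F))"
    using sum_card_descendants_roots[OF F] assms(2)
    by (intro mult_left_mono) (auto simp del: of_nat_sum)
  finally show ?thesis .
qed

text \<open>The branching factor at \<open>u\<close> restores the weight of \<open>u\<close> in the
  exponent of its children's costs, so every node of the subtree is charged the same amount
  \<open>E\<close>. Summing over the children multiplies \<open>E\<close> by subtree sizes, and the
  own cost of \<open>u\<close> is one more \<open>E\<close>.\<close>

lemma call_cost_recursive:
  assumes F: "rooted_forest F" and u: "u \<in> pverts F" and "c \<ge> 0" "p \<ge> 0"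
  shows "2 powr (c * weight \<phi> u) * p + 1
      + 2 powr (c * weight \<phi> u) * (\<Sum>v\<in>callees F (Some u). call_cost F \<phi> c p v)
    \<le> call_cost F \<phi> c p u"
proof -
  define W where "W = weighted_depth F \<phi>"
  define S where "S = (\<Sum>v\<in>ancestors F u - {u}. weight \<phi> v)"
  define E where "E = (p + 1) * 2 powr (c * (W - S))"
  have anc: "(\<Sum>v\<in>ancestors F u. weight \<phi> v) = weight \<phi> u + S"
    unfolding S_def by (rule sum.remove) (use finite_ancestors[OF F u] in auto)
  \<comment> \<open>The path from the root through \<open>u\<close> weighs at most \<open>W\<close>,
    so what its proper ancestors leave over still covers \<open>u\<close>.\<close>
  have le: "weight \<phi> u \<le> W - S"
    using sum_weight_ancestors_le[OF F u, of \<phi>] anc by (simp add: W_def)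
  have E: "E \<ge> 0"
    using \<open>p \<ge> 0\<close> by (simp add: E_def)
  \<comment> \<open>The return step fits into the \<open>+ 1\<close> of \<open>p + 1\<close> because
    the power is at least 1.\<close>
  have "2 powr (c * weight \<phi> u) * p + 1 \<le> 2 powr (c * weight \<phi> u) * (p + 1)"
    using \<open>c \<ge> 0\<close> weight_nonneg[of \<phi> u] by (simp add: distrib_left ge_one_powr_ge_zero)
  also have "\<dots> \<le> E"
    using le assms(3,4) by (simp add: E_def mult.commute[of "p + 1"] mult_right_mono mult_left_mono)
  finally have own: "2 powr (c * weight \<phi> u) * p + 1 \<le> E" .
  have child: "2 powr (c * weight \<phi> u) * call_cost F \<phi> c p v = E * real (card (descendants F v))"
    if "v \<in> callees F (Some u)" for v
  proof -
    have v: "v \<in> children F u"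
      using that by (simp add: callees_def)
    have "ancestors F v - {v} = ancestors F u"
      using ancestors_child[OF F v] by blast
    moreover have "2 powr (c * weight \<phi> u) * 2 powr (c * (W - (weight \<phi> u + S))) = 2 powr (c * (W - S))"
      by (simp add: powr_add[symmetric] algebra_simps)
    ultimately show ?thesis
      by (simp add: call_cost_def E_def anc W_def)
  qed
  have "2 powr (c * weight \<phi> u) * p + 1
      + 2 powr (c * weight \<phi> u) * (\<Sum>v\<in>callees F (Some u). call_cost F \<phi> c p v)
      \<le> E + E * real (\<Sum>v\<in>callees F (Some u). card (descendants F v))"
    using own child by (simp add: sum_distrib_left)
  also have "\<dots> = E * real (1 + (\<Sum>v\<in>callees F (Some u). card (descendants F v)))"
    by (simp add: algebra_simps)
  also have "\<dots> \<le> E * real (card (descendants F u))"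
    using sum_card_descendants_children[OF F u] E by (intro mult_left_mono) (auto simp del: of_nat_add of_nat_sum)
  also have "\<dots> = call_cost F \<phi> c p u"
    by (simp add: call_cost_def E_def W_def S_def)
  finally show ?thesis .
qed

section \<open>Asymptotic bounds over a family of inputs\<close>

definition poly_bounded :: "'i set \<Rightarrow> ('i \<Rightarrow> nat) \<Rightarrow> ('i \<Rightarrow> nat) \<Rightarrow> bool" where
  "poly_bounded X n f \<longleftrightarrow> (\<exists>k::nat. \<forall>x\<in>X. f x \<le> k * n x ^ k)"

definition exp_bounded :: "real \<Rightarrow> 'i set \<Rightarrow> ('i \<Rightarrow> nat) \<Rightarrow> ('i \<Rightarrow> real) \<Rightarrow> bool" where
  "exp_bounded a X n f \<longleftrightarrow> (\<exists>c::real. \<forall>x\<in>X. f x \<le> 2 powr (c * real (n x) powr a))"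

lemma poly_bounded_const: "(\<And>x. x \<in> X \<Longrightarrow> n x \<ge> 1) \<Longrightarrow> poly_bounded X n (\<lambda>x. m)"
  unfolding poly_bounded_def by (intro exI[of _ m]) (simp add: Suc_le_eq)

lemma poly_bounded_n: "poly_bounded X n n"
  unfolding poly_bounded_def by (intro exI[of _ 1]) simp

lemma poly_bounded_add:
  assumes n: "\<And>x. x \<in> X \<Longrightarrow> n x \<ge> 1" and "poly_bounded X n f" "poly_bounded X n g"
  shows "poly_bounded X n (\<lambda>x. f x + g x)"
proof -
  obtain k l where k: "\<And>x. x \<in> X \<Longrightarrow> f x \<le> k * n x ^ k" and l: "\<And>x. x \<in> X \<Longrightarrow> g x \<le> l * n x ^ l"
    using assms(2,3) unfolding poly_bounded_def by blast
  have "f x + g x \<le> (k + l) * n x ^ (k + l)" if x: "x \<in> X" for x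
  proof -
    have "k * n x ^ k \<le> k * n x ^ (k + l)" "l * n x ^ l \<le> l * n x ^ (k + l)"
      using n[OF x] by (intro mult_left_mono power_increasing; simp)+
    then show ?thesis
      using k[OF x] l[OF x] unfolding distrib_right by linarith
  qed
  then show ?thesis unfolding poly_bounded_def by blast
qed

lemma poly_bounded_mult:
  assumes n: "\<And>x. x \<in> X \<Longrightarrow> n x \<ge> 1" and "poly_bounded X n f" "poly_bounded X n g"
  shows "poly_bounded X n (\<lambda>x. f x * g x)"
proof -
  obtain k l where k: "\<And>x. x \<in> X \<Longrightarrow> f x \<le> k * n x ^ k" and l: "\<And>x. x \<in> X \<Longrightarrow> g x \<le> l * n x ^ l"
    using assms(2,3) unfolding poly_bounded_def by blast
  \<comment> \<open>One number must serve as factor and as exponent; this one dominates both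
    \<open>k * l\<close> and \<open>k + l\<close>.\<close>
  have "f x * g x \<le> (k * l + k + l) * n x ^ (k * l + k + l)" if x: "x \<in> X" for x
  proof -
    have "f x * g x \<le> (k * n x ^ k) * (l * n x ^ l)"
      using k[OF x] l[OF x] by (rule mult_le_mono)
    also have "\<dots> = (k * l) * n x ^ (k + l)"
      by (simp add: power_add)
    also have "\<dots> \<le> (k * l + k + l) * n x ^ (k * l + k + l)"
      using n[OF x] by (intro mult_le_mono power_increasing) auto
    finally show ?thesis .
  qed
  then show ?thesis unfolding poly_bounded_def by blast
qed

lemma exp_bounded_mono:
  "exp_bounded a X n g \<Longrightarrow> (\<And>x. x \<in> X \<Longrightarrow> f x \<le> g x) \<Longrightarrow> exp_bounded a X n f"
  unfolding exp_bounded_def by (meson order_trans)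

lemma exp_bounded_mult:
  assumes "\<And>x. x \<in> X \<Longrightarrow> f x \<ge> 0" "\<And>x. x \<in> X \<Longrightarrow> g x \<ge> 0"
    and "exp_bounded a X n f" "exp_bounded a X n g"
  shows "exp_bounded a X n (\<lambda>x. f x * g x)"
proof -
  obtain c d where c: "\<And>x. x \<in> X \<Longrightarrow> f x \<le> 2 powr (c * real (n x) powr a)"
      and d: "\<And>x. x \<in> X \<Longrightarrow> g x \<le> 2 powr (d * real (n x) powr a)"
    using assms(3,4) unfolding exp_bounded_def by blast
  have "f x * g x \<le> 2 powr ((c + d) * real (n x) powr a)" if x: "x \<in> X" for x
    using mult_mono[OF c[OF x] d[OF x] _ assms(2)[OF x]]
    by (simp add: powr_add[symmetric] distrib_right)
  then show ?thesis unfolding exp_bounded_def by blast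
qed

lemma exp_bounded_add:
  assumes n: "\<And>x. x \<in> X \<Longrightarrow> n x \<ge> 1" and a: "a \<ge> 0"
    and "exp_bounded a X n f" "exp_bounded a X n g"
  shows "exp_bounded a X n (\<lambda>x. f x + g x)"
proof -
  obtain c d where c: "\<And>x. x \<in> X \<Longrightarrow> f x \<le> 2 powr (c * real (n x) powr a)"
      and d: "\<And>x. x \<in> X \<Longrightarrow> g x \<le> 2 powr (d * real (n x) powr a)"
    using assms(3,4) unfolding exp_bounded_def by blast
  \<comment> \<open>The sum is at most twice the larger bound; the doubling adds 1 to the exponent,
    which is absorbed because \<open>n x powr a\<close> is at least 1.\<close>
  have "f x + g x \<le> 2 powr ((1 + max c d) * real (n x) powr a)" if x: "x \<in> X" for x
  proof -
    let ?e = "max c d * real (n x) powr a"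
    have "f x \<le> 2 powr ?e" "g x \<le> 2 powr ?e"
      by (rule order_trans[OF c[OF x]], simp add: mult_right_mono)
        (rule order_trans[OF d[OF x]], simp add: mult_right_mono)
    moreover have "1 \<le> real (n x) powr a"
      using n[OF x] a by (simp add: ge_one_powr_ge_zero)
    then have "2 powr (1 + ?e) \<le> 2 powr ((1 + max c d) * real (n x) powr a)"
      by (simp add: distrib_right)
    ultimately show ?thesis
      by (simp add: powr_add)
  qed
  then show ?thesis unfolding exp_bounded_def by blast
qed

lemma exp_bounded_const:
  assumes n: "\<And>x. x \<in> X \<Longrightarrow> n x \<ge> 1" and a: "a \<ge> 0"
  shows "exp_bounded a X n (\<lambda>x. real m)"
  unfolding exp_bounded_def
proof (intro exI ballI)
  fix x assume "x \<in> X"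
  then have "1 \<le> real (n x) powr a"
    using n a by (simp add: ge_one_powr_ge_zero)
  then have "real m * 1 \<le> real m * real (n x) powr a"
    by (intro mult_left_mono) auto
  then have "2 powr real m \<le> 2 powr (real m * real (n x) powr a)"
    by simp
  moreover have "real m \<le> 2 powr real m"
    using less_imp_le[OF of_nat_less_two_power[of m, where ?'a = real]] by (simp add: powr_realpow)
  ultimately show "real m \<le> 2 powr (real m * real (n x) powr a)"
    by linarith
qed

text \<open>From \<open>ln n \<le> n powr a / a\<close>, which requires a positive exponent; the
  division by \<open>ln 2\<close> changes the base of the logarithm.\<close>

lemma exp_bounded_n:
  assumes n: "\<And>x. x \<in> X \<Longrightarrow> n x \<ge> 1" and a: "a > 0"
  shows "exp_bounded a X n (\<lambda>x. real (n x))"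
  unfolding exp_bounded_def
proof (intro exI ballI)
  fix x assume "x \<in> X"
  then have n1: "real (n x) \<ge> 1"
    using n by simp
  have "log 2 (real (n x)) \<le> (real (n x) powr a / a) / ln 2"
    unfolding log_def using ln_powr_bound[OF n1 a] by (intro divide_right_mono) auto
  then have "2 powr log 2 (real (n x)) \<le> 2 powr ((1 / (a * ln 2)) * real (n x) powr a)"
    by simp
  then show "real (n x) \<le> 2 powr ((1 / (a * ln 2)) * real (n x) powr a)"
    using n1 by simp
qed

lemma exp_bounded_poly:
  assumes n: "\<And>x. x \<in> X \<Longrightarrow> n x \<ge> 1" and a: "a > 0"
  shows "exp_bounded a X n (\<lambda>x. real k * real (n x) ^ l)"
proof (induction l)
  case 0
  then show ?case using exp_bounded_const[where X = X and n = n and a = a and m = k] n a by simp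
next
  case (Suc l)
  have "exp_bounded a X n (\<lambda>x. real (n x) * (real k * real (n x) ^ l))"
    by (rule exp_bounded_mult) (use Suc exp_bounded_n[OF n a] in auto)
  then show ?case by (simp add: mult.left_commute)
qed


section \<open>Time and space of forest recursion\<close>

lemma card_partition_le:
  assumes "finite A" "partition_on A P"
  shows "(\<Sum>W\<in>P. card W) = card A" "card P \<le> card A"
proof -
  have fin: "finite W" if "W \<in> P" for W
    using that assms partition_onD1 finite_subset by (metis Union_upper)
  show sum: "(\<Sum>W\<in>P. card W) = card A"
    by (rule product_partition[symmetric]) (use assms fin in auto)
  have "card P = (\<Sum>W\<in>P. 1)"
    by simp
  also have "\<dots> \<le> (\<Sum>W\<in>P. card W)"
    using fin partition_onD3[OF assms(2)] by (intro sum_mono) (metis One_nat_def Suc_leI card_gt_0_iff)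
  finally show "card P \<le> card A"
    unfolding sum .
qed

lemma card_le_square:
  assumes "E \<subseteq> V \<times> V" "finite V" "card V \<le> n"
  shows "card E \<le> n * n"
proof -
  have "card E \<le> card (V \<times> V)"
    using assms by (intro card_mono) auto
  also have "\<dots> \<le> n * n"
    using assms(3) by (simp add: card_cartesian_product mult_le_mono)
  finally show ?thesis .
qed

text \<open>Forest nodes correspond to parts, and nonempty disjoint parts cannot outnumber the
  vertices.\<close>

lemma card_forest_le:
  assumes "treedepth_decomposition (contraction G P) F \<phi>" "finite (pverts G)" "partition_on (pverts G) P"
  shows "card (pverts F) \<le> card (pverts G)"
proof -
  have "card (pverts F) = card P"
    using assms(1) by (auto simp: treedepth_decomposition_def contraction_def dest: bij_betw_same_card)
  then show ?thesis
    using card_partition_le(2)[OF assms(2,3)] by simp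
qed

text \<open>The three arc sets have at most \<open>n * n\<close> elements each; the linear term
  collects three vertex sets, the total size of the parts and the table \<open>phi\<close>.\<close>

lemma input_size_le:
  assumes G: "pair_graph (graph x)" and P: "partition_on (pverts (graph x)) (part x)"
    and H: "cgraph x = contraction (graph x) (part x)"
    and F: "treedepth_decomposition (cgraph x) (forest x) (phi x)"
    and n: "card (pverts (graph x)) = n"
  shows "input_size aux_size x \<le> 3 * (n * n) + 5 * n + 1 + aux_size (aux x)"
proof -
  interpret pair_graph "graph x" by (rule G)
  have finG: "finite (pverts (graph x))"
    by (rule pair_finite_verts)
  have "parcs (graph x) \<subseteq> pverts (graph x) \<times> pverts (graph x)"
    using arc_fst_in_verts arc_snd_in_verts by force
  then have G_arcs: "card (parcs (graph x)) \<le> n * n"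
    using finG n by (intro card_le_square[of _ "pverts (graph x)"]) auto
  have parts: "(\<Sum>W\<in>part x. card W) = n" "card (part x) \<le> n"
    using card_partition_le[OF finG P] n by auto
  have H_verts: "pverts (cgraph x) = part x"
    using H by (simp add: contraction_def)
  have H_arcs: "card (parcs (cgraph x)) \<le> n * n"
    using H parts(2) finite_elements[OF finG P]
    by (intro card_le_square[of _ "part x"]) (auto simp: contraction_def)
  have F_verts: "card (pverts (forest x)) \<le> n"
    using card_forest_le[OF F[unfolded H] finG P] n by simp
  have "rooted_forest (forest x)"
    using F by (simp add: treedepth_decomposition_def)
  then have F_arcs: "card (parcs (forest x)) \<le> n * n"
    using F_verts by (intro card_le_square[OF rooted_forest_arcs rooted_forest_finite])
  show ?thesis
    unfolding input_size_def H_verts using G_arcs parts H_arcs F_verts F_arcs n by linarith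
qed

section \<open>Time and space on a single input\<close>

lemma halts_within_mono: "halts_within A x S \<Longrightarrow> S \<le> T \<Longrightarrow> halts_within A x T"
  unfolding halts_within_def by (meson order_trans)

text \<open>Instantiates the potential bound with \<open>call_cost\<close>. For the main program
  \<open>K\<close> bounds the own time and also the number of calls to each root, hence its second
  occurrence as a factor.\<close>

lemma halts_within_forest:
  fixes A :: "(('v, 'f, 'x) input, 'f, 's, 'm) rec_alg"
  assumes F: "rooted_forest (forest x)"
    and calls: "\<And>fr. fr \<in> activations A x \<Longrightarrow> set (calls fr) \<subseteq> callees (forest x) (node fr)"
    and main: "\<And>fr. fr \<in> activations A x \<Longrightarrow> node fr = None \<Longrightarrow> real (own_time fr) \<le> K"
    and own: "\<And>fr u. fr \<in> activations A x \<Longrightarrow> node fr = Some u \<Longrightarrow>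
      real (own_time fr) \<le> 2 powr (c * weight (phi x) u) * p"
    and cnt: "\<And>fr u v. fr \<in> activations A x \<Longrightarrow> node fr = Some u \<Longrightarrow>
      real (count_list (calls fr) v) \<le> 2 powr (c * weight (phi x) u)"
    and nonneg: "c \<ge> 0" "p \<ge> 0" "K \<ge> 0"
  shows "halts_within A x
    (K + 1 + K * ((p + 1) * 2 powr (c * weighted_depth (forest x) (phi x)) * real (card (pverts (forest x)))))"
proof -
  define own' where "own' = (\<lambda>r. case r of None \<Rightarrow> K | Some u \<Rightarrow> 2 powr (c * weight (phi x) u) * p)"
  define cnt' where "cnt' = (\<lambda>r. case r of None \<Rightarrow> K | Some u \<Rightarrow> 2 powr (c * weight (phi x) u))"
  have "within_bounds (forest x) own' cnt' fr" if fr: "fr \<in> activations A x" for fr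
  proof (cases "node fr")
    case None
    have "real (count_list (calls fr) v) \<le> K" for v
    proof -
      have "count_list (calls fr) v \<le> own_time fr"
        using count_le_length length_calls_le_own_time[OF fr] by (rule order_trans)
      then show ?thesis
        using main[OF fr None] by linarith
    qed
    then show ?thesis
      using calls[OF fr] main[OF fr] None by (simp add: within_bounds_def own'_def cnt'_def)
  next
    case (Some u)
    then show ?thesis
      using calls[OF fr] own[OF fr] cnt[OF fr] by (simp add: within_bounds_def own'_def cnt'_def)
  qed
  then have "halts_within A x (own' None + 1 +
      cnt' None * (\<Sum>v\<in>callees (forest x) None. call_cost (forest x) (phi x) c p v))"
  proof (rule halts_within_recursive_bound)
    show "own' (Some v) + 1 + cnt' (Some v) *
        (\<Sum>w\<in>callees (forest x) (Some v). call_cost (forest x) (phi x) c p w)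
        \<le> call_cost (forest x) (phi x) c p v" if "v \<in> pverts (forest x)" for v
      using call_cost_recursive[OF F that nonneg(1,2)] by (simp add: own'_def cnt'_def)
  qed (use finite_callees[OF F] callees_subset[OF F] call_cost_nonneg nonneg in auto)
  moreover have "own' None + 1 + cnt' None * (\<Sum>v\<in>callees (forest x) None. call_cost (forest x) (phi x) c p v)
    \<le> K + 1 + K * ((p + 1) * 2 powr (c * weighted_depth (forest x) (phi x)) * real (card (pverts (forest x))))"
    using mult_left_mono[OF sum_call_cost_roots_le[OF F nonneg(2)] nonneg(3)]
    by (simp add: own'_def cnt'_def)
  ultimately show ?thesis
    by (rule halts_within_mono)
qed

lemma space_at_le:
  assumes F: "rooted_forest (forest x)"
    and calls: "\<And>fr. fr \<in> activations A x \<Longrightarrow> set (calls fr) \<subseteq> callees (forest x) (node fr)"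
    and mem: "\<And>fr. fr \<in> activations A x \<Longrightarrow> mem_size A (memory fr) \<le> M"
  shows "space_at aux_size A x t \<le> input_size aux_size x + (card (pverts (forest x)) + 1) * M"
proof -
  let ?fs = "frames (config_at A x t)"
  have "(\<Sum>fr\<leftarrow>?fs. mem_size A (memory fr)) \<le> (\<Sum>fr\<leftarrow>?fs. M)"
    by (intro sum_list_mono mem) (rule frames_config_at)
  also have "\<dots> = length ?fs * M"
    by (simp add: sum_list_triv)
  also have "\<dots> \<le> (card (pverts (forest x)) + 1) * M"
    by (intro mult_le_mono1 length_frames_le F calls)
  finally show ?thesis
    by (simp add: space_at_def)
qed

theorem theorem2p4:
  fixes A :: "(('v, 'f, 'x) input, 'f, 's, 'm) rec_alg"
    and X :: "('v, 'f, 'x) input set"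
    and objs :: "('v, 'f, 'x) input \<Rightarrow> (real ^ 'd) set set"
    and n :: "('v, 'f, 'x) input \<Rightarrow> nat"
    and aux_size :: "'x \<Rightarrow> nat"
    and \<rho> \<sigma> :: real and \<kappa> \<Delta> :: nat
  assumes "CARD('d) \<ge> 2"
    and "\<And>x. x \<in> X \<Longrightarrow> finite (objs x) \<and> card (objs x) = n x \<and> n x \<ge> 1"
    and "\<And>x. x \<in> X \<Longrightarrow> similarly_sized_fat \<rho> \<sigma> (objs x)"
    and "\<And>x. x \<in> X \<Longrightarrow> intersection_graph (graph x) (objs x)"
    and "\<And>x. x \<in> X \<Longrightarrow> dimension x = CARD('d)"
    and "\<And>x. x \<in> X \<Longrightarrow> kappa_partition \<kappa> (graph x) (part x)"
    and "\<And>x. x \<in> X \<Longrightarrow> cgraph x = contraction (graph x) (part x)"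
    and "\<And>x. x \<in> X \<Longrightarrow> \<forall>W\<in>pverts (cgraph x). out_degree (with_proj (cgraph x)) W \<le> \<Delta>"
    and "\<And>x. x \<in> X \<Longrightarrow> treedepth_decomposition (cgraph x) (forest x) (phi x)"
    and "\<exists>c::real. \<forall>x\<in>X. weighted_depth (forest x) (phi x) \<le> c * real (n x) powr (1 - 1 / CARD('d))"
    and "\<exists>k::nat. \<forall>x\<in>X. aux_size (aux x) \<le> k * n x ^ k"
    and "uses_forest A X n"
  shows "(\<exists>c::real. \<forall>x\<in>X. halts_within A x (2 powr (c * real (n x) powr (1 - 1 / CARD('d))))) \<and>
         (\<exists>k::nat. \<forall>x\<in>X. \<forall>t. space_at aux_size A x t \<le> k * n x ^ k)"
proof -
  define a where "a = 1 - 1 / real CARD('d)"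
  have a: "a > 0"
    using assms(1) by (simp add: a_def)
  have n1: "\<And>x. x \<in> X \<Longrightarrow> n x \<ge> 1"
    using assms(2) by blast
  have G: "pair_graph (graph x)" "card (pverts (graph x)) = n x" if "x \<in> X" for x
    using assms(2,4)[OF that] by (auto simp: intersection_graph_def dest: bij_betw_same_card)
  have P: "partition_on (pverts (graph x)) (part x)" if "x \<in> X" for x
    using assms(6)[OF that] by (simp add: kappa_partition_def)
  have F: "rooted_forest (forest x)" if "x \<in> X" for x
    using assms(9)[OF that] by (simp add: treedepth_decomposition_def)
  have card_F: "card (pverts (forest x)) \<le> n x" if x: "x \<in> X" for x
  proof -
    interpret pair_graph "graph x" by (rule G(1)[OF x])
    show ?thesis
      using card_forest_le[OF _ pair_finite_verts P[OF x]] assms(7,9)[OF x] G(2)[OF x] by auto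
  qed
  obtain c\<^sub>0 where depth: "\<And>x. x \<in> X \<Longrightarrow> weighted_depth (forest x) (phi x) \<le> c\<^sub>0 * real (n x) powr a"
    using assms(10) unfolding a_def by blast
  have uses: "(\<forall>x\<in>X. \<forall>fr\<in>activations A x. set (calls fr) \<subseteq> callees (forest x) (node fr))"
     "(\<exists>k::nat. \<forall>x\<in>X. \<forall>fr\<in>activations A x. node fr = None \<longrightarrow> own_time fr \<le> k * n x ^ k)"
     "(\<exists>(c::real) (k::nat). \<forall>x\<in>X. \<forall>fr\<in>activations A x. \<forall>u. node fr = Some u \<longrightarrow>
        real (own_time fr) \<le> 2 powr (c * weight (phi x) u) * (k * real (n x) ^ k))"
     "(\<exists>c::real. \<forall>x\<in>X. \<forall>fr\<in>activations A x. \<forall>u. node fr = Some u \<longrightarrow>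
        (\<forall>v. real (count_list (calls fr) v) \<le> 2 powr (c * weight (phi x) u)))"
     "(\<exists>k::nat. \<forall>x\<in>X. \<forall>fr\<in>activations A x. mem_size A (memory fr) \<le> k * n x ^ k)"
    using assms(12) unfolding uses_forest_def by simp_all
  have calls: "\<And>x fr. x \<in> X \<Longrightarrow> fr \<in> activations A x \<Longrightarrow> set (calls fr) \<subseteq> callees (forest x) (node fr)"
    using uses(1) by blast
  obtain k where main: "\<And>x fr. x \<in> X \<Longrightarrow> fr \<in> activations A x \<Longrightarrow> node fr = None \<Longrightarrow>
      own_time fr \<le> k * n x ^ k"
    using uses(2) by blast
  obtain c\<^sub>1 and l :: nat where own: "\<And>x fr u. x \<in> X \<Longrightarrow> fr \<in> activations A x \<Longrightarrow> node fr = Some u \<Longrightarrow>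
      real (own_time fr) \<le> 2 powr (c\<^sub>1 * weight (phi x) u) * (l * real (n x) ^ l)"
    using uses(3) by blast
  obtain c\<^sub>2 where cnt: "\<And>x fr u v. x \<in> X \<Longrightarrow> fr \<in> activations A x \<Longrightarrow> node fr = Some u \<Longrightarrow>
      real (count_list (calls fr) v) \<le> 2 powr (c\<^sub>2 * weight (phi x) u)"
    using uses(4) by blast
  obtain m where mem: "\<And>x fr. x \<in> X \<Longrightarrow> fr \<in> activations A x \<Longrightarrow> mem_size A (memory fr) \<le> m * n x ^ m"
    using uses(5) by blast
  \<comment> \<open>One constant for both time and branching. Weights are nonnegative, so enlarging
    the constant only weakens the bounds; \<open>c \<ge> 0\<close> makes the cost monotone in the
    weighted depth.\<close>
  define c where "c = max 0 (max c\<^sub>1 c\<^sub>2)"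
  have c: "c \<ge> 0"
    by (simp add: c_def)
  have c_mono: "2 powr (c\<^sub>1 * weight (phi x) u) \<le> 2 powr (c * weight (phi x) u)"
      "2 powr (c\<^sub>2 * weight (phi x) u) \<le> 2 powr (c * weight (phi x) u)" for x :: "('v, 'f, 'x) input" and u
    using weight_nonneg[of "phi x" u] by (auto simp: c_def intro!: mult_right_mono)

  let ?K = "\<lambda>x. real k * real (n x) ^ k" and ?p = "\<lambda>x. real l * real (n x) ^ l"
  let ?T = "\<lambda>x. ?K x + 1 + ?K x * ((?p x + 1) *
    2 powr (c * weighted_depth (forest x) (phi x)) * real (card (pverts (forest x))))"
  have halts: "halts_within A x (?T x)" if x: "x \<in> X" for x
  proof (rule halts_within_forest[OF F[OF x] calls[OF x]])
    fix fr assume fr: "fr \<in> activations A x"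
    show "real (own_time fr) \<le> ?K x" if "node fr = None"
      using of_nat_mono[OF main[OF x fr that], where 'a = real] by simp
    show "real (own_time fr) \<le> 2 powr (c * weight (phi x) u) * ?p x" if "node fr = Some u" for u
      by (rule order_trans[OF own[OF x fr that]]) (intro mult_right_mono c_mono, simp)
    show "real (count_list (calls fr) v) \<le> 2 powr (c * weight (phi x) u)" if "node fr = Some u" for u v
      by (rule order_trans[OF cnt[OF x fr that] c_mono(2)])
  qed (use c in auto)
  have "exp_bounded a X n ?T"
  proof -
    have one: "exp_bounded a X n (\<lambda>x. 1)"
      using exp_bounded_const[where X = X and n = n and a = a and m = 1] n1 a by simp
    have W: "exp_bounded a X n (\<lambda>x. 2 powr (c * weighted_depth (forest x) (phi x)))"
      unfolding exp_bounded_def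
    proof (intro exI ballI)
      fix x assume "x \<in> X"
      then show "2 powr (c * weighted_depth (forest x) (phi x)) \<le> 2 powr ((c * c\<^sub>0) * real (n x) powr a)"
        using mult_left_mono[OF depth c] by (simp add: mult.assoc)
    qed
    have forest: "exp_bounded a X n (\<lambda>x. real (card (pverts (forest x))))"
      by (rule exp_bounded_mono[OF exp_bounded_n[where X = X and n = n, OF n1 a]]) (use card_F in auto)
    show ?thesis
      by (intro exp_bounded_add exp_bounded_mult exp_bounded_poly one W forest n1 a)
        (use a in auto)
  qed
  then have time: "\<exists>c::real. \<forall>x\<in>X. halts_within A x (2 powr (c * real (n x) powr a))"
    unfolding exp_bounded_def by (meson halts halts_within_mono)

  have aux: "poly_bounded X n (\<lambda>x. aux_size (aux x))" and mem': "poly_bounded X n (\<lambda>x. m * n x ^ m)"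
    using assms(11) unfolding poly_bounded_def by blast+
  \<comment> \<open>The last product is the stack: at most \<open>n x + 1\<close> frames of size at
    most \<open>m * n x ^ m\<close>. The other terms bound the input size.\<close>
  have "poly_bounded X n (\<lambda>x. 3 * (n x * n x) + 5 * n x + 1 + aux_size (aux x) + (n x + 1) * (m * n x ^ m))"
    by (intro poly_bounded_add poly_bounded_mult poly_bounded_const poly_bounded_n aux mem' n1)
  moreover have "space_at aux_size A x t
      \<le> 3 * (n x * n x) + 5 * n x + 1 + aux_size (aux x) + (n x + 1) * (m * n x ^ m)" if x: "x \<in> X" for x t
  proof -
    have "(card (pverts (forest x)) + 1) * (m * n x ^ m) \<le> (n x + 1) * (m * n x ^ m)"
      using card_F[OF x] by (intro mult_le_mono1) simp
    then show ?thesis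
      using space_at_le[OF F[OF x] calls[OF x] mem[OF x], of aux_size t]
        input_size_le[OF G(1)[OF x] P[OF x] assms(7)[OF x] assms(9)[OF x] G(2)[OF x], of aux_size]
      by linarith
  qed
  ultimately have "\<exists>k::nat. \<forall>x\<in>X. \<forall>t. space_at aux_size A x t \<le> k * n x ^ k"
    unfolding poly_bounded_def by (meson order_trans)
  with time show ?thesis
    unfolding a_def by blast
qed

end
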